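(* Let $a < b$, let $f : [a,b] \to \mathbb{R}$ be an arbitrary real-valued function and let $t \in [a,b]$. (i) Let $(t_n)_{n \in \mathbb{N}} \subseteq L(f)$ be such that $t_n \downarrow t$. If $t \in L^+(f)$, then $\lim_{n \to \infty} f(t_n-) = f(t+) = \lim_{n \to \infty} f(t_n+)$. (ii) Let $(t_n)_{n \in \mathbb{N}} \subseteq L(f)$ be such that $t_n \uparrow t$. If $t \in L^-(f)$, then $\lim_{n \to \infty} f(t_n-) = f(t-) = \lim_{n \to \infty} f(t_n+)$. In each of these cases, $\lim_{n \to \infty} |f(t_n+) - f(t_n-)| = 0$.
   Context: For $f : [a,b] \to \mathbb{R}$, $f(t+)$ (for $t \in [a,b)$) and $f(t-)$ (for $t \in (a,b]$) denote the finite one-sided limits of $f$ at $t$, taken over $s > t$, respectively $s < t$. $L^+(f)$ is the set of $t \in [a,b)$ such that $f(t+)$ exists in $\mathbb{R}$; $L^-(f)$ is the set of $t \in (a,b]$ such that $f(t-)$ exists in $\mathbb{R}$; $L(f) := L^+(f) \cap L^-(f)$. The notation $t_n \downarrow t$ means $\lim_n t_n = t$ and $t < t_{n+1} < t_n$ for all $n$; $t_n \uparrow t$ means $\lim_n t_n = t$ and $t_n < t_{n+1} < t$ for all $n$. *)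

theory Defs
  imports "HOL-Analysis.Analysis"
begin

text \<open>
  A function \<open>f : [a,b] \<rightarrow> \<real>\<close> is represented by a total function on the reals whose values
  outside \<open>{a..b}\<close> are arbitrary. They never matter: the filter \<^term>\<open>at_right t\<close> is used only for
  \<open>t \<in> {a..<b}\<close> and \<^term>\<open>at_left t\<close> only for \<open>t \<in> {a<..b}\<close>, where they are generated
  by points of \<open>{a..b}\<close>. Where the one-sided limit does not exist, the two
  values below are unspecified.
\<close>

definition right_lim :: "(real \<Rightarrow> real) \<Rightarrow> real \<Rightarrow> real" where
  "right_lim f t = Lim (at_right t) f"

definition left_lim :: "(real \<Rightarrow> real) \<Rightarrow> real \<Rightarrow> real" where
  "left_lim f t = Lim (at_left t) f"

definition L_plus :: "real \<Rightarrow> real \<Rightarrow> (real \<Rightarrow> real) \<Rightarrow> real set" where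
  "L_plus a b f = {t \<in> {a..<b}. \<exists>l. (f \<longlongrightarrow> l) (at_right t)}"

definition L_minus :: "real \<Rightarrow> real \<Rightarrow> (real \<Rightarrow> real) \<Rightarrow> real set" where
  "L_minus a b f = {t \<in> {a<..b}. \<exists>l. (f \<longlongrightarrow> l) (at_left t)}"

definition L_both :: "real \<Rightarrow> real \<Rightarrow> (real \<Rightarrow> real) \<Rightarrow> real set" where
  "L_both a b f = L_plus a b f \<inter> L_minus a b f"

definition decreases_to :: "(nat \<Rightarrow> real) \<Rightarrow> real \<Rightarrow> bool" where
  "decreases_to s t \<longleftrightarrow> s \<longlonglongrightarrow> t \<and> (\<forall>n. t < s (Suc n) \<and> s (Suc n) < s n)"

definition increases_to :: "(nat \<Rightarrow> real) \<Rightarrow> real \<Rightarrow> bool" where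
  "increases_to s t \<longleftrightarrow> s \<longlonglongrightarrow> t \<and> (\<forall>n. s n < s (Suc n) \<and> s (Suc n) < t)"

end

theory Submission
  imports Defs
begin

text \<open>
  A one-sided limit of \<open>f\<close> at \<open>t\<close> controls \<open>f\<close> uniformly on a whole punctured half-neighbourhood
  \<open>N\<close> of \<open>t\<close>, and \<open>N\<close> is open. As soon as \<open>s n\<close> lies in \<open>N\<close>, all points near \<open>s n\<close>, on either
  side of it, lie in \<open>N\<close> too, so both one-sided limits of \<open>f\<close> at \<open>s n\<close> are limits of values close
  to the limit at \<open>t\<close> and are themselves close to it. The jump \<open>|f(s n +) - f(s n -)|\<close> then tends
  to \<open>0\<close>, as its two terms have the same limit. The argument does not see which side is
  involved, so it is carried out once, in \<open>local_limits_tendsto\<close>, and used for all four limits.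
\<close>

text \<open>
  If \<open>f\<close> is within \<open>e\<close> of \<open>l\<close> on the open set \<open>U \<inter> S\<close>, then it is so eventually along every
  filter that converges to a point of that set, and the non-strict bound \<open>dist (f x) l \<le> e\<close>
  passes to the limit.
\<close>
lemma local_limits_tendsto:
  fixes f :: "'a::topological_space \<Rightarrow> 'b::metric_space"
  assumes lim: "(f \<longlongrightarrow> l) (at t within S)"
    and S: "open S" "t \<notin> S"
    and s: "(s \<longlongrightarrow> t) G" "eventually (\<lambda>n. s n \<in> S) G"
    and F: "\<And>n. F n \<le> nhds (s n)" "\<And>n. F n \<noteq> bot"
    and g: "\<And>n. (f \<longlongrightarrow> g n) (F n)"
  shows "(g \<longlongrightarrow> l) G"
proof (rule tendstoI)
  fix e :: real assume "e > 0"
  then have "eventually (\<lambda>x. dist (f x) l < e / 2) (at t within S)"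
    using lim by (intro tendstoD) auto
  then obtain U where U: "open U" "t \<in> U"
    and punctured: "\<forall>x\<in>U. x \<noteq> t \<longrightarrow> x \<in> S \<longrightarrow> dist (f x) l < e / 2"
    unfolding eventually_at_topological by blast
  then have close: "dist (f x) l < e / 2" if "x \<in> U" "x \<in> S" for x
    using that S(2) by metis
  have "eventually (\<lambda>n. s n \<in> U) G"
    using s(1) U by (rule topological_tendstoD)
  with s(2) show "eventually (\<lambda>n. dist (g n) l < e) G"
  proof eventually_elim
    case (elim n)
    have "eventually (\<lambda>x. x \<in> U \<inter> S) (nhds (s n))"
      using U(1) S(1) elim by (intro eventually_nhds_in_open) auto
    then have "eventually (\<lambda>x. x \<in> U \<inter> S) (F n)"
      using F(1) by (rule filter_leD[rotated])
    then have "eventually (\<lambda>x. dist (f x) l \<le> e / 2) (F n)"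
      by eventually_elim (metis IntE close less_imp_le)
    moreover have "((\<lambda>x. dist (f x) l) \<longlongrightarrow> dist (g n) l) (F n)"
      by (intro tendsto_dist g tendsto_const)
    ultimately have "dist (g n) l \<le> e / 2"
      using F(2) by (intro tendsto_upperbound)
    with \<open>e > 0\<close> show ?case by simp
  qed
qed

lemma at_within_le_nhds: "at x within A \<le> nhds x"
  by (simp add: at_within_def)

lemma tendsto_right_lim: "t \<in> L_plus a b f \<Longrightarrow> (f \<longlongrightarrow> right_lim f t) (at_right t)"
  unfolding L_plus_def right_lim_def by (auto simp: tendsto_Lim[OF trivial_limit_at_right_real])

lemma tendsto_left_lim: "t \<in> L_minus a b f \<Longrightarrow> (f \<longlongrightarrow> left_lim f t) (at_left t)"
  unfolding L_minus_def left_lim_def by (auto simp: tendsto_Lim[OF trivial_limit_at_left_real])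

text \<open>
  The open set \<open>S\<close> stands for \<open>{t<..}\<close> or \<open>{..<t}\<close>, which makes \<open>at t within S\<close> the filter
  of the one-sided limit at \<open>t\<close> and treats decreasing and increasing sequences alike.
\<close>
lemma one_sided_limits_tendsto:
  fixes s :: "nat \<Rightarrow> real"
  assumes s: "range s \<subseteq> L_both a b f" "s \<longlonglongrightarrow> t" "\<And>n. s n \<in> S"
    and S: "open S" "t \<notin> S"
    and lim: "(f \<longlongrightarrow> l) (at t within S)"
  shows "(\<lambda>n. left_lim f (s n)) \<longlonglongrightarrow> l \<and> (\<lambda>n. right_lim f (s n)) \<longlonglongrightarrow> l \<and>
    (\<lambda>n. \<bar>right_lim f (s n) - left_lim f (s n)\<bar>) \<longlonglongrightarrow> 0"
proof -
  have mem: "s n \<in> L_plus a b f" "s n \<in> L_minus a b f" for n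
    using s(1) by (auto simp: L_both_def)
  have S_ev: "eventually (\<lambda>n. s n \<in> S) sequentially"
    using s(3) by simp
  have left: "(\<lambda>n. left_lim f (s n)) \<longlonglongrightarrow> l"
    by (rule local_limits_tendsto[OF lim S s(2) S_ev, where F = "\<lambda>n. at_left (s n)"])
      (simp_all add: at_within_le_nhds tendsto_left_lim[OF mem(2)])
  have right: "(\<lambda>n. right_lim f (s n)) \<longlonglongrightarrow> l"
    by (rule local_limits_tendsto[OF lim S s(2) S_ev, where F = "\<lambda>n. at_right (s n)"])
      (simp_all add: at_within_le_nhds tendsto_right_lim[OF mem(1)])
  show ?thesis
    using left right tendsto_rabs[OF tendsto_diff[OF right left]] by simp
qed

text \<open>
  The definition bounds only the terms from index \<open>1\<close> on; the bound at index \<open>0\<close> comes from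
  monotonicity.
\<close>
lemma decreases_to_gt: "decreases_to s t \<Longrightarrow> t < s n"
  unfolding decreases_to_def by (blast intro: less_trans[of t "s (Suc n)" "s n"])

lemma increases_to_less: "increases_to s t \<Longrightarrow> s n < t"
  unfolding increases_to_def by (blast intro: less_trans[of "s n" "s (Suc n)" t])

theorem lemma2p3:
  fixes a b t :: real and f :: "real \<Rightarrow> real"
  assumes "a < b" and "t \<in> {a..b}"
  shows "(\<forall>s :: nat \<Rightarrow> real. range s \<subseteq> L_both a b f \<and> decreases_to s t \<and> t \<in> L_plus a b f \<longrightarrow>
            (\<lambda>n. left_lim f (s n)) \<longlonglongrightarrow> right_lim f t \<and>
            (\<lambda>n. right_lim f (s n)) \<longlonglongrightarrow> right_lim f t \<and>
            (\<lambda>n. \<bar>right_lim f (s n) - left_lim f (s n)\<bar>) \<longlonglongrightarrow> 0) \<and>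
         (\<forall>s :: nat \<Rightarrow> real. range s \<subseteq> L_both a b f \<and> increases_to s t \<and> t \<in> L_minus a b f \<longrightarrow>
            (\<lambda>n. left_lim f (s n)) \<longlonglongrightarrow> left_lim f t \<and>
            (\<lambda>n. right_lim f (s n)) \<longlonglongrightarrow> left_lim f t \<and>
            (\<lambda>n. \<bar>right_lim f (s n) - left_lim f (s n)\<bar>) \<longlonglongrightarrow> 0)"
proof (rule conjI; rule allI; rule impI; elim conjE)
  fix s :: "nat \<Rightarrow> real"
  assume s: "range s \<subseteq> L_both a b f" "decreases_to s t" and t: "t \<in> L_plus a b f"
  have "s \<longlonglongrightarrow> t" using s(2) by (simp add: decreases_to_def)
  then show "(\<lambda>n. left_lim f (s n)) \<longlonglongrightarrow> right_lim f t \<and>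
      (\<lambda>n. right_lim f (s n)) \<longlonglongrightarrow> right_lim f t \<and>
      (\<lambda>n. \<bar>right_lim f (s n) - left_lim f (s n)\<bar>) \<longlonglongrightarrow> 0"
    by (rule one_sided_limits_tendsto[OF s(1) _ _ _ _ tendsto_right_lim[OF t]])
      (simp_all add: decreases_to_gt[OF s(2)])
next
  fix s :: "nat \<Rightarrow> real"
  assume s: "range s \<subseteq> L_both a b f" "increases_to s t" and t: "t \<in> L_minus a b f"
  have "s \<longlonglongrightarrow> t" using s(2) by (simp add: increases_to_def)
  then show "(\<lambda>n. left_lim f (s n)) \<longlonglongrightarrow> left_lim f t \<and>
      (\<lambda>n. right_lim f (s n)) \<longlonglongrightarrow> left_lim f t \<and>
      (\<lambda>n. \<bar>right_lim f (s n) - left_lim f (s n)\<bar>) \<longlonglongrightarrow> 0"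
    by (rule one_sided_limits_tendsto[OF s(1) _ _ _ _ tendsto_left_lim[OF t]])
      (simp_all add: increases_to_less[OF s(2)])
qed

end
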